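(* There exists a weak $q$-$g$-matroid which is not a $q$-$\Delta$-matroid. That is, there exist a finite field $\mathbb{F}_q$, an integer $n$, and a family $\mathcal{F}$ of subspaces of $E=\mathbb{F}_q^n$ such that $(E,\mathcal{F})$ is a weak $q$-$g$-matroid but not a $q$-$\Delta$-matroid.
   Context: Let $E$ be a finite-dimensional vector space over a field. A $q$-matroid on $E$ is a pair $M=(E,r)$ with $r$ an integer-valued function on the subspaces of $E$ such that (R1) $0\le r(A)\le\dim A$ for every subspace $A$; (R2) $r(A)\le r(B)$ whenever $A\subseteq B$; (R3) $r(A+B)+r(A\cap B)\le r(A)+r(B)$ for all subspaces $A,B$. A subspace $A$ is independent if $r(A)=\dim A$; a basis is an inclusion-maximal independent subspace. A weak $q$-$g$-matroid is a pair $(E,\mathcal{F})$ for which there exist $q$-matroids $M_1,M_2$ on $E$ such that every basis of $M_2$ is contained in a basis of $M_1$, every basis of $M_1$ contains a basis of $M_2$, and $\mathcal{F}$ is the set of all subspaces $F\subseteq E$ for which there exist a basis $B_2$ of $M_2$ and a basis $B_1$ of $M_1$ with $B_2\subseteq F\subseteq B_1$. A $q$-$\Delta$-matroid is a pair $(E,\mathcal{F})$ with $\mathcal{F}$ a non-empty family of subspaces of $E$ satisfying: (F1) For all $X,Y\in\mathcal{F}$ and each subspace $A$ of codimension $1$ in $X$, either (i) there is a codimension-$1$ subspace $Z\subseteq E$ with $A\subseteq Z$, $Y\not\subseteq Z$, such that $A+z\in\mathcal{F}$ for all $1$-dimensional $z\subseteq E$ with $z\not\subseteq Z$; or (ii)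 there is a codimension-$1$ subspace $Z\subseteq E$ such that $Z\cap A\in\mathcal{F}$. (F2) For all $X,Y\in\mathcal{F}$ and each subspace $A\subseteq E$ in which $X$ has codimension $1$, either (iii) there is a $1$-dimensional $z\subseteq A$, $z\not\subseteq Y$, such that $A\cap Z\in\mathcal{F}$ for every codimension-$1$ subspace $Z\subseteq E$ with $z\not\subseteq Z$; or (iv) there is a $1$-dimensional $z\subseteq E$ such that $A+z\in\mathcal{F}$. *)

theory Defs
  imports "Jordan_Normal_Form.Missing_VectorSpace"
begin

locale fin_dim_vectorspace = vectorspace K E for K and E (structure) +
  assumes fin_dim: "fin_dim"
begin

definition subspaces :: "'c set set" where
  "subspaces = {A. VectorSpace.subspace K A E}"

definition sdim :: "'c set \<Rightarrow> nat" where
  "sdim A = vectorspace.dim K (vs A)"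

definition codim1_in :: "'c set \<Rightarrow> 'c set \<Rightarrow> bool" where
  "codim1_in A X \<longleftrightarrow> A \<in> subspaces \<and> X \<in> subspaces \<and> A \<subseteq> X \<and> sdim X = sdim A + 1"

definition hyperplanes :: "'c set set" where
  "hyperplanes = {Z. codim1_in Z (carrier E)}"

definition lines :: "'c set set" where
  "lines = {z \<in> subspaces. sdim z = 1}"

end

text \<open>\<open>r\<close> is total on sets of vectors; it is constrained, and used, only on subspaces.\<close>

locale q_matroid = fin_dim_vectorspace K E for K and E (structure) +
  fixes r :: "'c set \<Rightarrow> int"
  assumes R1: "A \<in> subspaces \<Longrightarrow> 0 \<le> r A \<and> r A \<le> int (sdim A)"
    and R2: "A \<in> subspaces \<Longrightarrow> B \<in> subspaces \<Longrightarrow> A \<subseteq> B \<Longrightarrow> r A \<le> r B"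
    and R3: "A \<in> subspaces \<Longrightarrow> B \<in> subspaces \<Longrightarrow>
               r (submodule_sum A B) + r (A \<inter> B) \<le> r A + r B"
begin

definition indep :: "'c set \<Rightarrow> bool" where
  "indep A \<longleftrightarrow> A \<in> subspaces \<and> r A = int (sdim A)"

definition bases :: "'c set set" where
  "bases = {B. indep B \<and> (\<forall>A. indep A \<and> B \<subseteq> A \<longrightarrow> A = B)}"

end

definition weak_q_g_matroid ::
  "('a, 'b) ring_scheme \<Rightarrow> ('a, 'c, 'd) module_scheme \<Rightarrow> 'c set set \<Rightarrow> bool" where
  "weak_q_g_matroid K E \<F> \<longleftrightarrow>
     (\<exists>r\<^sub>1 r\<^sub>2. q_matroid K E r\<^sub>1 \<and> q_matroid K E r\<^sub>2 \<and>
        (\<forall>B\<^sub>2 \<in> q_matroid.bases K E r\<^sub>2. \<exists>B\<^sub>1 \<in> q_matroid.bases K E r\<^sub>1. B\<^sub>2 \<subseteq> B\<^sub>1) \<and>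
        (\<forall>B\<^sub>1 \<in> q_matroid.bases K E r\<^sub>1. \<exists>B\<^sub>2 \<in> q_matroid.bases K E r\<^sub>2. B\<^sub>2 \<subseteq> B\<^sub>1) \<and>
        \<F> = {F \<in> fin_dim_vectorspace.subspaces K E.
               \<exists>B\<^sub>2 \<in> q_matroid.bases K E r\<^sub>2. \<exists>B\<^sub>1 \<in> q_matroid.bases K E r\<^sub>1.
                 B\<^sub>2 \<subseteq> F \<and> F \<subseteq> B\<^sub>1})"

locale q_delta_matroid = fin_dim_vectorspace K E for K and E (structure) +
  fixes \<F> :: "'c set set"
  assumes nonempty: "\<F> \<noteq> {}"
    and family: "\<F> \<subseteq> subspaces"
    and F1: "X \<in> \<F> \<Longrightarrow> Y \<in> \<F> \<Longrightarrow> codim1_in A X \<Longrightarrow>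
        (\<exists>Z \<in> hyperplanes. A \<subseteq> Z \<and> \<not> Y \<subseteq> Z \<and>
           (\<forall>z \<in> lines. \<not> z \<subseteq> Z \<longrightarrow> submodule_sum A z \<in> \<F>))
        \<or> (\<exists>Z \<in> hyperplanes. Z \<inter> A \<in> \<F>)"
    and F2: "X \<in> \<F> \<Longrightarrow> Y \<in> \<F> \<Longrightarrow> codim1_in X A \<Longrightarrow>
        (\<exists>z \<in> lines. z \<subseteq> A \<and> \<not> z \<subseteq> Y \<and>
           (\<forall>Z \<in> hyperplanes. \<not> z \<subseteq> Z \<longrightarrow> A \<inter> Z \<in> \<F>))
        \<or> (\<exists>z \<in> lines. submodule_sum A z \<in> \<F>)"

text \<open>The standard space \<open>K\<^sup>n\<close>, as coordinate functions on \<open>{0, \<dots>, n - 1}\<close>.\<close>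

abbreviation coord_space :: "('a, 'b) ring_scheme \<Rightarrow> nat \<Rightarrow> ('a, nat \<Rightarrow> 'a) module" where
  "coord_space K n \<equiv> ring.func_space K {..<n}"

end

theory Submission
  imports "HOL-Number_Theory.Residues" Defs
begin

text \<open>
  Over any field, let \<open>a, b, c, d\<close> be linearly independent in \<open>E\<close>, and put \<open>D = \<langle>a, b\<rangle>\<close>,
  \<open>L = \<langle>a, c\<rangle>\<close>. The \<open>q\<close>-matroid \<open>M\<^sub>1\<close> whose only circuit is \<open>D\<close> and the rank one \<open>q\<close>-matroid
  \<open>M\<^sub>2\<close> whose loops are the lines of \<open>L\<close> form a weak \<open>q\<close>-\<open>g\<close>-matroid; its members are the
  subspaces that neither contain \<open>D\<close> nor lie in \<open>L\<close>. Exchange (F1) fails for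
  \<open>X = Y = \<langle>a, b + c\<rangle>\<close> and \<open>A = \<langle>a\<rangle>\<close>: in (i) the hyperplane \<open>Z\<close> must contain \<open>b\<close>, since
  \<open>A + \<langle>b\<rangle> = D\<close>, and \<open>c\<close>, since \<open>A + \<langle>c\<rangle> = L\<close>, so \<open>Y \<subseteq> Z\<close>; and (ii) fails because \<open>A \<subseteq> L\<close>.
\<close>

section \<open>Spans and extension of independent sets to bases\<close>

context vectorspace
begin

lemma span_subset_subspace:
  assumes "S \<subseteq> W" "subspace K W V"
  shows "span S \<subseteq> W"
  using assms span_is_subset is_module by blast

lemma lin_indpt_insert:
  assumes "S \<subseteq> carrier V" "lin_indpt S" "v \<in> carrier V" "v \<notin> span S"
  shows "lin_indpt (insert v S)"
proof -
  have "v \<notin> S"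
    using assms in_own_span by blast
  with lin_dep_iff_in_span[OF assms(1-3)] assms(4) show ?thesis
    by simp
qed

lemma subspace_carrier_subset:
  assumes "subspace K W V"
  shows "W \<subseteq> carrier V"
  using assms by (auto simp: subspace_def submodule_def)

text \<open>Cardinalities of independent sets are bounded by \<open>dim\<close>, so among those
  between \<open>C\<close> and \<open>W\<close> there is a maximal one. A vector of \<open>W\<close>
  outside its span could still be adjoined.\<close>

lemma basis_extension:
  assumes "fin_dim" "subspace K W V" "C \<subseteq> W" "lin_indpt C"
  obtains B where "finite B" "C \<subseteq> B" "B \<subseteq> W" "lin_indpt B" "span B = W"
proof -
  have WV: "W \<subseteq> carrier V"
    by (rule subspace_carrier_subset) fact
  define P where "P = (\<lambda>S. C \<subseteq> S \<and> S \<subseteq> W \<and> lin_indpt S)"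
  have "P S \<Longrightarrow> finite S \<and> card S \<le> dim" for S
    using li_le_dim[OF assms(1), of S] WV by (auto simp: P_def)
  moreover have "P C"
    using assms by (simp add: P_def)
  ultimately obtain B where B: "finite B" "maximal B P"
    using maximal_exists[of P dim C] by blast
  then have PB: "C \<subseteq> B" "B \<subseteq> W" "lin_indpt B"
    by (auto simp: P_def maximal_def)
  have "W \<subseteq> span B"
  proof
    fix w
    assume w: "w \<in> W"
    show "w \<in> span B"
    proof (rule ccontr)
      assume *: "w \<notin> span B"
      have "lin_indpt (insert w B)"
        using lin_indpt_insert[OF _ PB(3) _ *] w PB WV by blast
      then have "P (insert w B)"
        using PB w by (auto simp: P_def)
      then have "insert w B = B"
        using B by (auto simp: maximal_def)
      then show False
        using * in_own_span[of B] PB WV by blast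
    qed
  qed
  moreover have "span B \<subseteq> W"
    using span_subset_subspace PB assms by blast
  ultimately show thesis
    using that B PB by blast
qed

end

section \<open>Dimension of subspaces\<close>

context fin_dim_vectorspace
begin

lemma carrier_mem_subspaces: "carrier E \<in> subspaces"
  using vectorspace_axioms module_axioms
  by (auto simp: subspaces_def subspace_def submodule_def)

lemma sum_mem_subspaces:
  "A \<in> subspaces \<Longrightarrow> B \<in> subspaces \<Longrightarrow> submodule_sum A B \<in> subspaces"
  by (simp add: subspaces_def sum_is_subspace)

lemma inter_mem_subspaces:
  "A \<in> subspaces \<Longrightarrow> B \<in> subspaces \<Longrightarrow> A \<inter> B \<in> subspaces"
  by (auto simp: subspaces_def subspace_def submodule_def)

lemma span_mem_subspaces: "S \<subseteq> carrier E \<Longrightarrow> span S \<in> subspaces"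
  by (simp add: subspaces_def span_is_subspace)

lemma span_subset_iff:
  assumes "S \<subseteq> carrier E" "A \<in> subspaces"
  shows "span S \<subseteq> A \<longleftrightarrow> S \<subseteq> A"
  using assms in_own_span span_subset_subspace unfolding subspaces_def by blast

lemma sdim_span:
  assumes "S \<subseteq> carrier E" "lin_indpt S"
  shows "sdim (span S) = card S"
proof -
  have sub: "VectorSpace.subspace K (span S) E"
    using assms span_is_subspace by blast
  interpret W: vectorspace K "vs (span S)"
    using sub by (rule subspace_is_vs)
  have "S \<subseteq> span S"
    using assms in_own_span by blast
  then have "W.basis S"
    using span_li_not_depend[of S "span S"] assms sub by (simp add: W.basis_def)
  moreover have "finite S"
    using fin_dim_li_fin fin_dim assms by blast
  ultimately show ?thesis
    using W.dim_basis by (simp add: sdim_def)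
qed

lemma subspace_basis_extension:
  assumes "A \<in> subspaces" "C \<subseteq> A" "lin_indpt C"
  obtains B where "finite B" "C \<subseteq> B" "B \<subseteq> A" "B \<subseteq> carrier E" "lin_indpt B" "span B = A"
    "sdim A = card B"
proof -
  have A: "VectorSpace.subspace K A E"
    using assms by (simp add: subspaces_def)
  obtain B where "finite B" "C \<subseteq> B" "B \<subseteq> A" "lin_indpt B" "span B = A"
    using basis_extension[OF fin_dim A assms(2,3)] .
  moreover from this have "B \<subseteq> carrier E"
    using subspace_carrier_subset A by blast
  ultimately show thesis
    using sdim_span that by blast
qed

lemma lin_indpt_empty: "lin_indpt {}"
  by (rule finite_lin_indpt2) auto

lemma subspace_basis:
  assumes "A \<in> subspaces"
  obtains B where "finite B" "B \<subseteq> A" "B \<subseteq> carrier E" "lin_indpt B" "span B = A"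
    "sdim A = card B"
  by (rule subspace_basis_extension[OF assms empty_subsetI lin_indpt_empty]) (rule that)

text \<open>A basis of \<open>A\<close> extends to a basis of \<open>B\<close>, and properly so
  because the spans differ.\<close>

lemma sdim_mono_strict:
  assumes "A \<in> subspaces" "B \<in> subspaces" "A \<subset> B"
  shows "sdim A < sdim B"
proof -
  obtain S where S: "finite S" "S \<subseteq> A" "lin_indpt S" "span S = A" "sdim A = card S"
    by (rule subspace_basis[OF assms(1)])
  obtain T where T: "finite T" "S \<subseteq> T" "span T = B" "sdim B = card T"
    by (rule subspace_basis_extension[OF assms(2)
          subset_trans[OF S(2) psubset_imp_subset[OF assms(3)]] S(3)])
  have "S \<noteq> T"
    using S T assms(3) by auto
  with S T show ?thesis
    by (simp add: psubset_card_mono psubsetI)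
qed

lemma sdim_mono:
  assumes "A \<in> subspaces" "B \<in> subspaces" "A \<subseteq> B"
  shows "sdim A \<le> sdim B"
proof (cases "A = B")
  case False
  with assms show ?thesis
    using sdim_mono_strict[of A B] by (simp add: psubset_eq)
qed simp

lemma sdim_span_insert:
  assumes "S \<subseteq> carrier E" "v \<in> carrier E" "v \<notin> span S"
  shows "sdim (span (insert v S)) = sdim (span S) + 1"
proof -
  \<comment> \<open>\<open>S\<close> may be dependent or infinite, so it is replaced by a basis
    \<open>T\<close> of its span.\<close>
  obtain T where T: "finite T" "T \<subseteq> carrier E" "lin_indpt T" "span T = span S"
      "sdim (span S) = card T"
    by (rule subspace_basis[OF span_mem_subspaces[OF assms(1)]])
  have "span (insert v S) = span (insert v T)"
    using span_union_is_sum[of "{v}" S] span_union_is_sum[of "{v}" T] assms T by simp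
  moreover have "lin_indpt (insert v T)" "v \<notin> T"
    using lin_indpt_insert[of T v] T assms in_own_span[of T] by blast+
  ultimately show ?thesis
    using sdim_span[of "insert v T"] T assms by simp
qed

lemma sdim_span_singleton:
  assumes "v \<in> carrier E" "v \<noteq> \<zero>\<^bsub>E\<^esub>"
  shows "sdim (span {v}) = 1"
  using sdim_span_insert[of "{}" v] sdim_span[of "{}"] lin_indpt_empty assms
  by (simp add: span_empty)

text \<open>A basis of \<open>A \<inter> B\<close> extends to bases \<open>S\<close> of \<open>A\<close> and \<open>T\<close> of \<open>B\<close>, and \<open>S \<union> T\<close> spans \<open>A + B\<close>.\<close>
lemma sdim_submodular:
  assumes "A \<in> subspaces" "B \<in> subspaces"
  shows "sdim (submodule_sum A B) + sdim (A \<inter> B) \<le> sdim A + sdim B"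
proof -
  obtain U where U: "U \<subseteq> A \<inter> B" "lin_indpt U" "sdim (A \<inter> B) = card U"
    by (rule subspace_basis[OF inter_mem_subspaces[OF assms]])
  obtain S where S: "finite S" "U \<subseteq> S" "S \<subseteq> carrier E" "span S = A" "sdim A = card S"
    by (rule subspace_basis_extension[OF assms(1) subset_trans[OF U(1) Int_lower1] U(2)])
  obtain T where T: "finite T" "U \<subseteq> T" "T \<subseteq> carrier E" "span T = B" "sdim B = card T"
    by (rule subspace_basis_extension[OF assms(2) subset_trans[OF U(1) Int_lower2] U(2)])
  let ?W = "submodule_sum A B"
  have span: "span (S \<union> T) = ?W"
    using span_union_is_sum[OF S(3) T(3)] S(4) T(4) by simp
  have W: "VectorSpace.subspace K ?W E"
    using sum_mem_subspaces[OF assms] by (simp add: subspaces_def)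
  interpret W: vectorspace K "vs ?W"
    using W by (rule subspace_is_vs)
  have "S \<union> T \<subseteq> ?W"
    using in_own_span[of "S \<union> T"] S T span by blast
  then have "W.span (S \<union> T) = ?W"
    using span_li_not_depend(1)[of "S \<union> T" ?W] W span by simp
  then have "sdim ?W \<le> card (S \<union> T)"
    using W.gen_ge_dim[of "S \<union> T"] S(1) T(1) \<open>S \<union> T \<subseteq> ?W\<close> by (simp add: sdim_def)
  moreover have "card U \<le> card (S \<inter> T)"
    using S T by (intro card_mono) auto
  moreover have "card (S \<union> T) + card (S \<inter> T) = card S + card T"
    using card_Un_Int[of S T] S T by simp
  ultimately show ?thesis
    using U S T by linarith
qed

lemma subset_sum:
  assumes "A \<in> subspaces" "B \<in> subspaces"
  shows "A \<subseteq> submodule_sum A B" "B \<subseteq> submodule_sum A B"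
  using assms in_sum_vs[of A B] in_sum_vs[of B A] vsum_comm[of A B] by (auto simp: subspaces_def)

section \<open>The two q-matroids and the extension of independent subspaces to bases\<close>

text \<open>For (R2), a proper inclusion raises the dimension by at least one, which pays for the
  possible correction. For (R3), if \<open>D\<close> lies in one of \<open>A\<close>,
  \<open>B\<close> it lies in the sum, and if it lies in both it lies in the intersection; the rest
  is submodularity of \<open>sdim\<close>.\<close>

lemma q_matroid_circuit:
  assumes D: "D \<in> subspaces" "0 < sdim D"
  shows "q_matroid K E (\<lambda>A. int (sdim A) - of_bool (D \<subseteq> A))"
proof unfold_locales
  fix A B
  assume A: "A \<in> subspaces"
  show "0 \<le> int (sdim A) - of_bool (D \<subseteq> A) \<and> int (sdim A) - of_bool (D \<subseteq> A) \<le> int (sdim A)"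
    using sdim_mono[OF D(1) A] D(2) by auto
  assume B: "B \<in> subspaces"
  show "int (sdim A) - of_bool (D \<subseteq> A) \<le> int (sdim B) - of_bool (D \<subseteq> B)" if "A \<subseteq> B"
  proof (cases "A = B")
    case False
    then have "sdim A < sdim B"
      using sdim_mono_strict[OF A B] that by (simp add: psubset_eq)
    then show ?thesis
      using that by (auto simp: of_bool_def)
  qed simp
  show "int (sdim (submodule_sum A B)) - of_bool (D \<subseteq> submodule_sum A B)
      + (int (sdim (A \<inter> B)) - of_bool (D \<subseteq> A \<inter> B))
      \<le> int (sdim A) - of_bool (D \<subseteq> A) + (int (sdim B) - of_bool (D \<subseteq> B))"
    using sdim_submodular[OF A B] subset_sum[OF A B] by auto
qed

text \<open>(R3) holds because the sum escapes \<open>L\<close> exactly when \<open>A\<close> or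
  \<open>B\<close> does, while the intersection can escape only when both do.\<close>

lemma q_matroid_rank_one:
  assumes L: "L \<in> subspaces"
  shows "q_matroid K E (\<lambda>A. of_bool (\<not> A \<subseteq> L))"
proof unfold_locales
  fix A B
  assume A: "A \<in> subspaces"
  have "1 \<le> sdim A" if "\<not> A \<subseteq> L"
  proof -
    have "A \<inter> L \<subset> A"
      using that by auto
    then show ?thesis
      using sdim_mono_strict[OF inter_mem_subspaces[OF A L] A] by linarith
  qed
  then show "0 \<le> (of_bool (\<not> A \<subseteq> L) :: int) \<and> of_bool (\<not> A \<subseteq> L) \<le> int (sdim A)"
    by (cases "A \<subseteq> L") simp_all
  assume B: "B \<in> subspaces"
  show "(of_bool (\<not> A \<subseteq> L) :: int) \<le> of_bool (\<not> B \<subseteq> L)" if "A \<subseteq> B"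
    using that by auto
  have "submodule_sum A B \<subseteq> L \<longleftrightarrow> A \<subseteq> L \<and> B \<subseteq> L"
    using vsum_is_minimal A B L by (simp add: subspaces_def)
  then show "(of_bool (\<not> submodule_sum A B \<subseteq> L) :: int) + of_bool (\<not> A \<inter> B \<subseteq> L)
      \<le> of_bool (\<not> A \<subseteq> L) + of_bool (\<not> B \<subseteq> L)"
    by auto
qed

end

text \<open>An independent subspace of greatest dimension above \<open>A\<close> is also
  inclusion-maximal, as proper inclusion strictly raises \<open>sdim\<close>.\<close>

lemma (in q_matroid) indep_extends_to_basis:
  assumes "indep A"
  obtains B where "B \<in> bases" "A \<subseteq> B"
proof -
  define P where "P = (\<lambda>B. indep B \<and> A \<subseteq> B)"
  have "sdim B \<le> sdim (carrier E)" if "P B" for B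
    using that sdim_mono carrier_mem_subspaces subspace_carrier_subset
    by (auto simp: P_def indep_def subspaces_def)
  moreover have "P A"
    using assms by (simp add: P_def)
  ultimately obtain B where B: "P B" "\<And>C. P C \<Longrightarrow> sdim C \<le> sdim B"
    using ex_has_greatest_nat[of P A sdim "Suc (sdim (carrier E))"]
    by (metis le_imp_less_Suc)
  have "C = B" if "indep C" "B \<subseteq> C" for C
  proof (rule ccontr)
    assume "C \<noteq> B"
    with that B(1) have "sdim B < sdim C"
      by (intro sdim_mono_strict) (auto simp: P_def indep_def)
    moreover have "P C"
      using that B(1) by (auto simp: P_def)
    ultimately show False
      using B(2) by fastforce
  qed
  with B(1) that show thesis
    by (auto simp: P_def bases_def)
qed

section \<open>The counterexample built from four independent vectors\<close>

context fin_dim_vectorspace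
begin

lemma zero_mem: "S \<in> subspaces \<Longrightarrow> \<zero>\<^bsub>E\<^esub> \<in> S"
  by (simp add: subspaces_def subspace_def submodule_def)

lemma add_mem: "S \<in> subspaces \<Longrightarrow> u \<in> S \<Longrightarrow> v \<in> S \<Longrightarrow> u \<oplus>\<^bsub>E\<^esub> v \<in> S"
  by (simp add: subspaces_def subspace_def submodule_def)

lemma mem_if_add_mem:
  assumes "S \<in> subspaces" "v \<in> S" "u \<oplus>\<^bsub>E\<^esub> v \<in> S" "u \<in> carrier E"
  shows "u \<in> S"
proof -
  have v: "v \<in> carrier E"
    using assms subspace_carrier_subset by (auto simp: subspaces_def)
  have "(\<ominus>\<^bsub>K\<^esub> \<one>\<^bsub>K\<^esub>) \<odot>\<^bsub>E\<^esub> v \<in> S"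
    using assms by (simp add: subspaces_def subspace_def submodule_def)
  then have "\<ominus>\<^bsub>E\<^esub> v \<in> S"
    using smult_minus_1[OF v] by simp
  from add_mem[OF assms(1,3) this] show ?thesis
    using assms v by (simp add: M.a_assoc M.r_neg)
qed

text \<open>The hypotheses express independence of the four vectors in the forms used below:
  \<open>b\<close> keeps \<open>D\<close> out of \<open>W\<close> and \<open>x\<close> out of
  \<open>L\<close>, \<open>c\<close> separates \<open>X\<close> from \<open>D\<close>, and
  \<open>d\<close> makes \<open>W\<close> strictly larger than \<open>L\<close>.\<close>

lemma weak_q_g_matroid_not_q_delta_matroid:
  assumes carr: "a \<in> carrier E" "b \<in> carrier E" "c \<in> carrier E" "d \<in> carrier E"
    and a: "a \<noteq> \<zero>\<^bsub>E\<^esub>"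
    and b: "b \<notin> span {a, c, d}"
    and c: "c \<notin> span {a, b}"
    and d: "d \<notin> span {a, c}"
  shows "\<exists>\<F>. weak_q_g_matroid K E \<F> \<and> \<not> q_delta_matroid K E \<F>"
proof -
  define x where "x = b \<oplus>\<^bsub>E\<^esub> c"
  define A D L W X where "A = span {a}" and "D = span {a, b}" and "L = span {a, c}"
    and "W = span {a, c, d}" and "X = span {x, a}"
  note defs = A_def D_def L_def W_def X_def
  have x: "x \<in> carrier E"
    using carr by (simp add: x_def)
  have sub: "A \<in> subspaces" "D \<in> subspaces" "L \<in> subspaces" "W \<in> subspaces" "X \<in> subspaces"
    unfolding defs using carr x by (auto intro!: span_mem_subspaces)
  have mem: "a \<in> A" "a \<in> D" "b \<in> D" "a \<in> L" "c \<in> L" "a \<in> X" "x \<in> X" "d \<in> W"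
    unfolding defs using carr x by (auto intro!: subsetD[OF in_own_span])
  have LW: "L \<subseteq> W"
    unfolding defs by (rule span_is_monotone) auto
  have AL: "A \<subseteq> L"
    unfolding defs by (rule span_is_monotone) auto
  have AX: "A \<subseteq> X"
    unfolding defs by (rule span_is_monotone) auto
  have bL: "b \<notin> L"
    using b LW by (auto simp: W_def)
  have DW: "\<not> D \<subseteq> W"
    using b mem by (auto simp: W_def)
  have xL: "x \<notin> L"
    using mem_if_add_mem[of L c b] sub mem carr bL by (auto simp: x_def)
  have xA: "x \<notin> A"
    using xL AL by auto
  have sdimA: "sdim A = 1"
    unfolding defs using carr a by (intro sdim_span_singleton)
  have sdimX: "sdim X = sdim A + 1"
    unfolding defs using carr x xA by (intro sdim_span_insert) (auto simp: A_def)
  have "b \<notin> A"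
    using bL AL by auto
  then have sdimD: "sdim D = sdim A + 1"
    unfolding defs using carr sdim_span_insert[of "{a}" b] by (simp add: insert_commute)
  \<comment> \<open>\<open>X\<close> and \<open>D\<close> are both planes, so \<open>D\<close>
    inside \<open>X\<close> would force equality, and then \<open>c\<close>, the difference of
    \<open>x\<close> and \<open>b\<close>, would lie in \<open>D\<close>.\<close>
  have "X \<noteq> D"
  proof
    assume "X = D"
    then have "c \<oplus>\<^bsub>E\<^esub> b \<in> D"
      using mem carr by (simp add: x_def M.a_comm)
    then have "c \<in> D"
      using mem_if_add_mem[of D b c] sub mem carr by simp
    then show False
      using c by (simp add: D_def)
  qed
  then have DX: "\<not> D \<subseteq> X"
    using sdim_mono_strict[OF sub(2) sub(5)] sdimX sdimD by auto
  define r1 r2 where "r1 = (\<lambda>S. int (sdim S) - of_bool (D \<subseteq> S))"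
    and "r2 = (\<lambda>S. (of_bool (\<not> S \<subseteq> L) :: int))"
  have r1: "r1 S = int (sdim S) - of_bool (D \<subseteq> S)" and r2: "r2 S = of_bool (\<not> S \<subseteq> L)" for S
    by (simp_all add: r1_def r2_def)
  interpret M1: q_matroid K E r1
    unfolding r1_def by (rule q_matroid_circuit) (simp_all add: sub sdimD)
  interpret M2: q_matroid K E r2
    unfolding r2_def by (rule q_matroid_rank_one) (rule sub)
  have indep1: "M1.indep S \<longleftrightarrow> S \<in> subspaces \<and> \<not> D \<subseteq> S" for S
    by (auto simp: M1.indep_def r1)
  have basis1: "B \<in> subspaces" "\<not> D \<subseteq> B" if "B \<in> M1.bases" for B
    using that indep1 by (auto simp: M1.bases_def)
  have line2: "span {v} \<in> M2.bases" if v: "v \<in> carrier E" "v \<notin> L" for v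
  proof -
    have S: "span {v} \<in> subspaces" "\<not> span {v} \<subseteq> L" "sdim (span {v}) = 1"
      using v zero_mem[OF sub(3)] span_mem_subspaces[of "{v}"] sub span_subset_iff[of "{v}" L]
        sdim_span_singleton[of v]
      by auto
    \<comment> \<open>The rank \<open>r2\<close> never exceeds 1, so no independent subspace is
      larger than a line.\<close>
    have "T = span {v}" if "M2.indep T" "span {v} \<subseteq> T" for T
    proof (rule ccontr)
      assume "T \<noteq> span {v}"
      with that have "1 < sdim T"
        using sdim_mono_strict[of "span {v}" T] S by (auto simp: M2.indep_def)
      then show False
        using that by (cases "T \<subseteq> L") (auto simp: M2.indep_def r2)
    qed
    then show ?thesis
      using S by (auto simp: M2.bases_def M2.indep_def r2)
  qed
  have basis2: "B \<in> subspaces" "\<not> B \<subseteq> L" "sdim B = 1" if B: "B \<in> M2.bases" for B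
  proof -
    show *: "B \<in> subspaces"
      using that by (auto simp: M2.bases_def M2.indep_def)
    show **: "\<not> B \<subseteq> L"
    proof
      \<comment> \<open>Rank 0 makes \<open>B\<close> the zero space, which is not maximal: it lies
        in the basis \<open>span {b}\<close>.\<close>
      assume BL: "B \<subseteq> L"
      then have "sdim B = 0"
        using B by (auto simp: M2.bases_def M2.indep_def r2)
      have "span {} \<subseteq> B"
        using zero_mem[OF *] by (simp add: span_empty)
      then have "B = {\<zero>\<^bsub>E\<^esub>}"
        using sdim_mono_strict[of "span {}" B] span_mem_subspaces[of "{}"] * \<open>sdim B = 0\<close>
        by (auto simp: span_empty)
      then have "B \<subseteq> span {b}"
        using zero_mem[of "span {b}"] span_mem_subspaces carr by auto
      moreover have "span {b} \<in> M2.bases"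
        using line2 carr bL by blast
      ultimately have "span {b} = B"
        using B by (auto simp: M2.bases_def)
      then have "b \<in> B"
        using in_own_span[of "{b}"] carr by simp
      with BL bL show False
        by auto
    qed
    show "sdim B = 1"
      using B ** by (auto simp: M2.bases_def M2.indep_def r2)
  qed
  define \<F> where "\<F> = {F \<in> subspaces. \<exists>B2\<in>M2.bases. \<exists>B1\<in>M1.bases. B2 \<subseteq> F \<and> F \<subseteq> B1}"
  \<comment> \<open>The refutation of (F1) rests on these two necessary conditions for membership
    together with \<open>XF\<close>.\<close>
  have F_indep: "\<not> D \<subseteq> F" if "F \<in> \<F>" for F
    using that basis1 by (fastforce simp: \<F>_def)
  have F_spanning: "\<not> F \<subseteq> L" if "F \<in> \<F>" for F
    using that basis2 by (fastforce simp: \<F>_def)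
  have XF: "X \<in> \<F>"
  proof -
    have "M1.indep X"
      using indep1 sub DX by simp
    then obtain B1 where "B1 \<in> M1.bases" "X \<subseteq> B1"
      using M1.indep_extends_to_basis by blast
    moreover have "span {x} \<in> M2.bases"
      using line2 x xL by blast
    moreover have "span {x} \<subseteq> X"
      using span_subset_iff x sub mem by simp
    ultimately show ?thesis
      using sub by (auto simp: \<F>_def)
  qed
  have weak1: "\<exists>B1\<in>M1.bases. B2 \<subseteq> B1" if "B2 \<in> M2.bases" for B2
  proof -
    \<comment> \<open>Bases of \<open>M2\<close> are lines, too small to contain the plane
      \<open>D\<close>.\<close>
    have "\<not> D \<subseteq> B2"
      using sdim_mono[OF sub(2), of B2] basis2[OF that] sdimA sdimD by auto
    then have "M1.indep B2"
      using indep1 basis2[OF that] by simp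
    then show ?thesis
      using M1.indep_extends_to_basis by blast
  qed
  have weak2: "\<exists>B2\<in>M2.bases. B2 \<subseteq> B1" if B1: "B1 \<in> M1.bases" for B1
  proof -
    \<comment> \<open>A basis inside \<open>L\<close> would lie in the independent space
      \<open>W\<close>, hence equal it, although \<open>d\<close> is in \<open>W\<close> and not in
      \<open>L\<close>.\<close>
    have "\<not> B1 \<subseteq> L"
    proof
      assume "B1 \<subseteq> L"
      moreover have "M1.indep W"
        using indep1 sub DW by simp
      ultimately have "W = B1"
        using B1 LW by (auto simp: M1.bases_def)
      with \<open>B1 \<subseteq> L\<close> mem d show False
        by (auto simp: L_def)
    qed
    then obtain v where v: "v \<in> B1" "v \<notin> L"
      by auto
    have "B1 \<subseteq> carrier E"
      using basis1[OF B1] subspace_carrier_subset by (simp add: subspaces_def)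
    then have "span {v} \<in> M2.bases" "span {v} \<subseteq> B1"
      using line2[of v] v span_subset_iff[of "{v}" B1] basis1[OF B1] by auto
    then show ?thesis
      by blast
  qed
  have "weak_q_g_matroid K E \<F>"
    unfolding weak_q_g_matroid_def \<F>_def
    using M1.q_matroid_axioms M2.q_matroid_axioms weak1 weak2 by blast
  moreover have "\<not> q_delta_matroid K E \<F>"
  proof
    assume delta: "q_delta_matroid K E \<F>"
    have "codim1_in A X"
      using sub AX sdimX by (simp add: codim1_in_def)
    \<comment> \<open>Both members in the exchange are \<open>X\<close>.\<close>
    from q_delta_matroid.F1[OF delta XF XF this] consider
      Z where "Z \<in> hyperplanes" "A \<subseteq> Z" "\<not> X \<subseteq> Z"
        "\<forall>z\<in>lines. \<not> z \<subseteq> Z \<longrightarrow> submodule_sum A z \<in> \<F>"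
      | Z where "Z \<inter> A \<in> \<F>"
      by (elim disjE bexE conjE) auto
    then show False
    proof cases
      case 1
      then have Z: "Z \<in> subspaces"
        by (simp add: hyperplanes_def codim1_in_def)
      have sum: "span {a, v} \<in> \<F>" if v: "v \<in> carrier E" "v \<notin> Z" for v
      proof -
        have "v \<noteq> \<zero>\<^bsub>E\<^esub>"
          using v zero_mem[OF Z] by auto
        then have "span {v} \<in> lines"
          using span_mem_subspaces[of "{v}"] sdim_span_singleton v by (simp add: lines_def)
        moreover have "\<not> span {v} \<subseteq> Z"
          using span_subset_iff[of "{v}"] v Z by simp
        ultimately have "submodule_sum A (span {v}) \<in> \<F>"
          using 1(4) by blast
        moreover have "span {a, v} = submodule_sum A (span {v})"
          using span_union_is_sum[of "{a}" "{v}"] carr v by (simp add: A_def insert_commute)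
        ultimately show ?thesis
          by simp
      qed
      \<comment> \<open>If \<open>b\<close> were outside \<open>Z\<close>, then \<open>D\<close>
        itself would be in the family; likewise \<open>L\<close> for \<open>c\<close>.\<close>
      have "b \<in> Z"
        using sum[of b] F_indep[of D] carr by (auto simp: D_def)
      moreover have "c \<in> Z"
        using sum[of c] F_spanning[of L] carr by (auto simp: L_def)
      ultimately have "{x, a} \<subseteq> Z"
        using add_mem[OF Z] 1(2) mem by (auto simp: x_def)
      then have "X \<subseteq> Z"
        using span_subset_iff[of "{x, a}" Z] Z carr x by (simp add: X_def)
      with 1 show False
        by simp
    next
      case 2
      then show False
        using F_spanning AL by blast
    qed
  qed
  ultimately show ?thesis
    by blast
qed

end

section \<open>Coordinate spaces over a finite field\<close>

lemma (in field) func_space_vectorspace: "vectorspace R (func_space S)"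
  using func_space_is_module field_axioms by (auto simp: vectorspace_def)

text \<open>Serves to separate a unit vector from the span of others, on which its coordinate
  vanishes.\<close>

lemma (in field) coordinate_hyperplane:
  "VectorSpace.subspace R {f \<in> carrier (func_space S). f i = \<zero>} (func_space S)" if "i \<in> S"
proof -
  interpret V: vectorspace R "func_space S"
    by (rule func_space_vectorspace)
  show ?thesis
    using V.vectorspace_axioms V.module_axioms that
    by (auto simp: subspace_def submodule_def) (simp_all add: func_space_def)
qed

text \<open>Over a finite field the whole carrier is a finite generating set, so no explicit basis
  has to be produced.\<close>

lemma (in field) fin_dim_func_space:
  assumes "finite (carrier R)" "finite S"
  shows "fin_dim_vectorspace R (func_space S)"
proof -
  interpret V: vectorspace R "func_space S"
    by (rule func_space_vectorspace)
  have "finite (carrier (func_space S))"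
    using assms by (auto simp: func_space_def intro: finite_PiE)
  then have "V.fin_dim"
    using V.in_own_span[of "carrier (func_space S)"] V.span_is_subset2 
    unfolding V.fin_dim_def by blast
  then show ?thesis
    by unfold_locales
qed

theorem proposition4p8:
  shows "\<exists>(K :: int ring) (n :: nat) (\<F> :: (nat \<Rightarrow> int) set set).
           field K \<and> finite (carrier K) \<and>
           weak_q_g_matroid K (coord_space K n) \<F> \<and>
           \<not> q_delta_matroid K (coord_space K n) \<F>"
proof -
  \<comment> \<open>The field with two elements; dimension 4 leaves room for the four independent
    vectors.\<close>
  define K where "K = residue_ring (int 2)"
  interpret K: residues_prime 2 K
    by unfold_locales (simp_all add: K_def)
  let ?E = "K.func_space {..<4::nat}"
  interpret E: fin_dim_vectorspace K ?E
    by (rule K.fin_dim_func_space) auto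
  define e where "e i = (\<lambda>j\<in>{..<4::nat}. if j = i then \<one>\<^bsub>K\<^esub> else \<zero>\<^bsub>K\<^esub>)" for i
  have e: "e i \<in> carrier ?E" for i
    by (auto simp: e_def K.func_space_def)
  have notin: "e i \<notin> E.span (e ` I)" if "i < 4" "i \<notin> I" for i I
  proof -
    let ?H = "{f \<in> carrier ?E. f i = \<zero>\<^bsub>K\<^esub>}"
    have "E.span (e ` I) \<subseteq> ?H"
      using that e by (intro E.span_subset_subspace K.coordinate_hyperplane) (auto simp: e_def)
    moreover have "e i \<notin> ?H"
      using that by (simp add: e_def)
    ultimately show ?thesis
      by blast
  qed
  \<comment> \<open>The empty index set gives the zero space as span.\<close>
  have "e 0 \<noteq> \<zero>\<^bsub>?E\<^esub>"
    using notin[of 0 "{}"] by (simp add: E.span_empty)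
  then have "\<exists>\<F>. weak_q_g_matroid K ?E \<F> \<and> \<not> q_delta_matroid K ?E \<F>"
    using E.weak_q_g_matroid_not_q_delta_matroid[of "e 0" "e 1" "e 2" "e 3"] e
      notin[of 1 "{0, 2, 3}"] notin[of 2 "{0, 1}"] notin[of 3 "{0, 2}"] by simp
  then show ?thesis
    using K.field_axioms K.finite by blast
qed

end
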